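(* Let $\mathbb{F}$ be a field and let $A$ be an ACI-matrix over $\mathbb{F}$ of constant rank $\rho$. Then $A$ has a core; that is, there is an ACI-matrix $A'$ which is completely irreducible of constant rank $\rho$ such that $$A\sim\begin{bmatrix} A' & * \\ * & *\end{bmatrix},$$ where the blocks $*$ are arbitrary and may be void.
   Context: An ACI-matrix over a field $\mathbb{F}$ is a matrix with entries in a polynomial ring $\mathbb{F}[x_1,\ldots,x_k]$ whose entries are polynomials of degree at most one and such that no indeterminate appears in two different columns. A completion of an ACI-matrix is the matrix over $\mathbb{F}$ obtained by assigning a value in $\mathbb{F}$ to each indeterminate. An ACI-matrix has constant rank $\rho$ if every completion of it has rank $\rho$. Matrices with no rows or no columns are allowed and have rank $0$. Two $m\times n$ ACI-matrices $A,B$ are equivalent, written $A\sim B$, if there exist a nonsingular constant matrix $T$ of order $m$ (entries in $\mathbb{F}$) and a permutation matrix $Q$ of order $n$ with $TAQ=B$. Let $A$ be an ACI-matrix of constant rank $\rho$. $A$ is row reducible if some row of $A$ can be deleted so that the resulting ACI-matrix still has constant rank $\rho$, and row irreducible otherwise. $A$ is column reducible if some column of $A$ can be deleted so that the resulting ACI-matrix still has constant rank $\rho$, and column irreducible otherwise. $A$ is reducible if it is row reducible or column reducible, and irreducible otherwise. $A$ is completely irreducible if every ACI-matrix equivalent to $A$ is irreducible. If $A\sim\begin{bmatrix} A' & * \\ * & *\end{bmatrix}$ where $A'$ is completely irreducible of constant rank $\rho$ (the rank of $A$), then $A'$ is called a core of $A$. *)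

theory Defs
  imports
    "HOL-Library.Poly_Mapping"
    "HOL-Combinatorics.Permutations"
    "Jordan_Normal_Form.DL_Rank"
    "Jordan_Normal_Form.DL_Submatrix"
begin

text \<open>
  Polynomials are finitely supported maps from monomials to coefficients, monomials being
  finitely supported maps from indeterminates to exponents; the ring structure is the one of
  \<^theory>\<open>HOL-Library.Poly_Mapping\<close>. There are countably many indeterminates \<open>x\<^sub>0, x\<^sub>1, \<dots>\<close>, but
  a matrix involves only finitely many of them, so this amounts to working over
  \<open>F[x\<^sub>1, \<dots>, x\<^sub>k]\<close> for an arbitrary finite number \<open>k\<close> (possibly 0) of indeterminates.
\<close>

type_synonym 'a mpoly = "(nat \<Rightarrow>\<^sub>0 nat) \<Rightarrow>\<^sub>0 'a"

definition monom_degree :: "(nat \<Rightarrow>\<^sub>0 nat) \<Rightarrow> nat" where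
  "monom_degree m = (\<Sum>v\<in>Poly_Mapping.keys m. Poly_Mapping.lookup m v)"

definition degree_at_most :: "nat \<Rightarrow> 'a::zero mpoly \<Rightarrow> bool" where
  "degree_at_most d p \<longleftrightarrow> (\<forall>m\<in>Poly_Mapping.keys p. monom_degree m \<le> d)"

definition indets :: "'a::zero mpoly \<Rightarrow> nat set" where
  "indets p = (\<Union>m\<in>Poly_Mapping.keys p. Poly_Mapping.keys m)"

definition eval_mpoly :: "(nat \<Rightarrow> 'a) \<Rightarrow> 'a::comm_ring_1 mpoly \<Rightarrow> 'a" where
  "eval_mpoly \<alpha> p =
    (\<Sum>m\<in>Poly_Mapping.keys p. Poly_Mapping.lookup p m *
      (\<Prod>v\<in>Poly_Mapping.keys m. \<alpha> v ^ Poly_Mapping.lookup m v))"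

definition const_mpoly :: "'a::zero \<Rightarrow> 'a mpoly" where
  "const_mpoly c = Poly_Mapping.single 0 c"

definition aci_matrix :: "'a::zero mpoly mat \<Rightarrow> bool" where
  "aci_matrix A \<longleftrightarrow>
    (\<forall>i<dim_row A. \<forall>j<dim_col A. degree_at_most 1 (A $$ (i, j))) \<and>
    (\<forall>i<dim_row A. \<forall>i'<dim_row A. \<forall>j<dim_col A. \<forall>j'<dim_col A.
      j \<noteq> j' \<longrightarrow> indets (A $$ (i, j)) \<inter> indets (A $$ (i', j')) = {})"

definition completion :: "(nat \<Rightarrow> 'a) \<Rightarrow> 'a::comm_ring_1 mpoly mat \<Rightarrow> 'a mat" where
  "completion \<alpha> A = map_mat (eval_mpoly \<alpha>) A"

definition constant_rank :: "'a::field mpoly mat \<Rightarrow> nat \<Rightarrow> bool" where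
  "constant_rank A \<rho> \<longleftrightarrow> (\<forall>\<alpha>. vec_space.rank (dim_row A) (completion \<alpha> A) = \<rho>)"

definition permutation_matrix :: "nat \<Rightarrow> 'a::zero_neq_one mat \<Rightarrow> bool" where
  "permutation_matrix n Q \<longleftrightarrow>
    (\<exists>\<pi>. \<pi> permutes {..<n} \<and> Q = mat n n (\<lambda>(i, j). if i = \<pi> j then 1 else 0))"

definition aci_equiv :: "'a::field mpoly mat \<Rightarrow> 'a mpoly mat \<Rightarrow> bool" where
  "aci_equiv A B \<longleftrightarrow>
    aci_matrix A \<and> aci_matrix B \<and>
    dim_row A = dim_row B \<and> dim_col A = dim_col B \<and>
    (\<exists>T Q. T \<in> carrier_mat (dim_row A) (dim_row A) \<and> invertible_mat T \<and>
      permutation_matrix (dim_col A) Q \<and>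
      map_mat const_mpoly T * A * Q = B)"

definition delete_row :: "nat \<Rightarrow> 'a mat \<Rightarrow> 'a mat" where
  "delete_row i A = submatrix A (- {i}) UNIV"

definition delete_col :: "nat \<Rightarrow> 'a mat \<Rightarrow> 'a mat" where
  "delete_col j A = submatrix A UNIV (- {j})"

text \<open>
  Reducibility is meant for ACI-matrices of constant rank only. Since every matrix has a
  completion, the number \<open>\<rho>\<close> below is unique when it exists. A matrix that is not of constant
  rank is not reducible in the sense below, which is why \<open>is_core\<close> demands constant rank
  separately.
\<close>

definition row_reducible :: "'a::field mpoly mat \<Rightarrow> bool" where
  "row_reducible A \<longleftrightarrow>
    (\<exists>\<rho>. constant_rank A \<rho> \<and> (\<exists>i<dim_row A. constant_rank (delete_row i A) \<rho>))"

definition column_reducible :: "'a::field mpoly mat \<Rightarrow> bool" where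
  "column_reducible A \<longleftrightarrow>
    (\<exists>\<rho>. constant_rank A \<rho> \<and> (\<exists>j<dim_col A. constant_rank (delete_col j A) \<rho>))"

definition aci_reducible :: "'a::field mpoly mat \<Rightarrow> bool" where
  "aci_reducible A \<longleftrightarrow> row_reducible A \<or> column_reducible A"

definition completely_irreducible :: "'a::field mpoly mat \<Rightarrow> bool" where
  "completely_irreducible A \<longleftrightarrow> (\<forall>B. aci_equiv A B \<longrightarrow> \<not> aci_reducible B)"

text \<open>The dimensions \<open>p\<close> and \<open>q\<close> may be 0, in which case the corresponding blocks are void.\<close>

definition is_core :: "'a::field mpoly mat \<Rightarrow> 'a mpoly mat \<Rightarrow> bool" where
  "is_core A' A \<longleftrightarrow>
    aci_matrix A' \<and> completely_irreducible A' \<and>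
    (\<exists>\<rho>. constant_rank A \<rho> \<and> constant_rank A' \<rho>) \<and>
    (\<exists>p q B C D.
      B \<in> carrier_mat (dim_row A') q \<and>
      C \<in> carrier_mat p (dim_col A') \<and>
      D \<in> carrier_mat p q \<and>
      aci_equiv A (four_block_mat A' B C D))"

end

theory Submission
  imports Defs
begin

text \<open>
  If a matrix equivalent to \<open>A\<close> is reducible, a row or column can be deleted without changing the
  constant rank, so iterating terminates in a completely irreducible matrix. To be the leading
  block of a matrix equivalent to \<open>A\<close> is a transitive relation (extend the transformation of the
  smaller matrix by an identity block), and it comprises both equivalence and deletion.
\<close>

definition leading_block :: "'a::field mpoly mat \<Rightarrow> 'a mpoly mat \<Rightarrow> bool" where
  "leading_block B A \<longleftrightarrow> dim_row B \<le> dim_row A \<and> dim_col B \<le> dim_col A \<and>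
    (\<exists>T S \<pi>. T \<in> carrier_mat (dim_row A) (dim_row A) \<and> S \<in> carrier_mat (dim_row A) (dim_row A) \<and>
      T * S = 1\<^sub>m (dim_row A) \<and> S * T = 1\<^sub>m (dim_row A) \<and> \<pi> permutes {..<dim_col A} \<and>
      (\<forall>i<dim_row B. \<forall>j<dim_col B.
        B $$ (i, j) = (\<Sum>k<dim_row A. const_mpoly (T $$ (i, k)) * A $$ (k, \<pi> j))))"

lemma leading_blockI:
  assumes "dim_row B \<le> dim_row A" "dim_col B \<le> dim_col A"
    and "T \<in> carrier_mat (dim_row A) (dim_row A)" "S \<in> carrier_mat (dim_row A) (dim_row A)"
    and "T * S = 1\<^sub>m (dim_row A)" "S * T = 1\<^sub>m (dim_row A)" "\<pi> permutes {..<dim_col A}"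
    and "\<And>i j. i < dim_row B \<Longrightarrow> j < dim_col B \<Longrightarrow>
      B $$ (i, j) = (\<Sum>k<dim_row A. const_mpoly (T $$ (i, k)) * A $$ (k, \<pi> j))"
  shows "leading_block B A"
  unfolding leading_block_def using assms by blast

section \<open>Linear combinations of polynomials with constant coefficients\<close>

lemma lookup_const_mpoly_mult:
  "Poly_Mapping.lookup (const_mpoly (c::'a::comm_ring_1) * p) m = c * Poly_Mapping.lookup p m"
proof -
  have "const_mpoly c * p = Poly_Mapping.map ((*) c) p"
    by (simp add: const_mpoly_def mult_map_scale_conv_mult)
  then show ?thesis by (simp add: Poly_Mapping.map.rep_eq when_def)
qed

lemma const_mpoly_0: "const_mpoly 0 = (0 :: 'a::comm_ring_1 mpoly)"
  and const_mpoly_1: "const_mpoly 1 = (1 :: 'a::comm_ring_1 mpoly)"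
  by (simp_all add: const_mpoly_def)

lemma const_mpoly_mult: "const_mpoly (a * b :: 'a::comm_ring_1) = const_mpoly a * const_mpoly b"
  by (simp add: const_mpoly_def Poly_Mapping.mult_single)

lemma const_mpoly_sum: "const_mpoly (\<Sum>i\<in>I. f i :: 'a::comm_ring_1) = (\<Sum>i\<in>I. const_mpoly (f i))"
  by (induction I rule: infinite_finite_induct)
    (simp_all add: const_mpoly_def Poly_Mapping.single_add)

text \<open>Scaling by a constant acts on each coefficient separately, so no new monomial can arise,
  though some may cancel. Both the degree bound and the bound on the indeterminates of a combination
  follow from this inclusion.\<close>

lemma keys_const_mpoly_sum:
  "Poly_Mapping.keys (\<Sum>k\<in>K. const_mpoly (c k :: 'a::comm_ring_1) * p k)
    \<subseteq> (\<Union>k\<in>K. Poly_Mapping.keys (p k))"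
proof -
  have "Poly_Mapping.keys (const_mpoly (c k) * p k) \<subseteq> Poly_Mapping.keys (p k)" for k
    by (auto simp: in_keys_iff lookup_const_mpoly_mult)
  then show ?thesis
    by (rule order_trans[OF Poly_Mapping.keys_sum UN_mono[OF order_refl]])
qed

lemma degree_at_most_const_mpoly_sum:
  assumes "\<And>k. k \<in> K \<Longrightarrow> degree_at_most d (p k)"
  shows "degree_at_most d (\<Sum>k\<in>K. const_mpoly (c k :: 'a::comm_ring_1) * p k)"
  using assms keys_const_mpoly_sum[of c p K] unfolding degree_at_most_def by blast

lemma indets_const_mpoly_sum:
  "indets (\<Sum>k\<in>K. const_mpoly (c k :: 'a::comm_ring_1) * p k) \<subseteq> (\<Union>k\<in>K. indets (p k))"
  using keys_const_mpoly_sum[of c p K] unfolding indets_def by fastforce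

text \<open>Monomials outside the support contribute zero. This allows several polynomials with
  different supports to be evaluated over one common index set.\<close>

lemma eval_mpoly_superset:
  assumes "finite M" "Poly_Mapping.keys p \<subseteq> M"
  shows "eval_mpoly \<alpha> p =
    (\<Sum>m\<in>M. Poly_Mapping.lookup p m * (\<Prod>v\<in>Poly_Mapping.keys m. \<alpha> v ^ Poly_Mapping.lookup m v))"
  unfolding eval_mpoly_def using assms by (intro sum.mono_neutral_left) (auto simp: in_keys_iff)

lemma eval_mpoly_const_mpoly_sum:
  assumes "finite K"
  shows "eval_mpoly \<alpha> (\<Sum>k\<in>K. const_mpoly (c k) * p k) = (\<Sum>k\<in>K. c k * eval_mpoly \<alpha> (p k))"
proof -
  \<comment> \<open>The union of all supports serves as the common index set, so that the two sums
    can be interchanged.\<close>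
  define M where "M = (\<Union>k\<in>K. Poly_Mapping.keys (p k))"
  define e where "e m = (\<Prod>v\<in>Poly_Mapping.keys m. \<alpha> v ^ Poly_Mapping.lookup m v)"
    for m :: "nat \<Rightarrow>\<^sub>0 nat"
  have M: "finite M" unfolding M_def using assms by simp
  have "eval_mpoly \<alpha> (\<Sum>k\<in>K. const_mpoly (c k) * p k)
      = (\<Sum>m\<in>M. (\<Sum>k\<in>K. c k * Poly_Mapping.lookup (p k) m) * e m)"
    using eval_mpoly_superset[OF M keys_const_mpoly_sum[of c p K, folded M_def], of \<alpha>]
    by (simp add: e_def Poly_Mapping.lookup_sum lookup_const_mpoly_mult)
  also have "\<dots> = (\<Sum>k\<in>K. c k * (\<Sum>m\<in>M. Poly_Mapping.lookup (p k) m * e m))"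
    by (simp add: sum_distrib_right sum_distrib_left mult.assoc sum.swap[of _ M])
  also have "\<dots> = (\<Sum>k\<in>K. c k * eval_mpoly \<alpha> (p k))"
    unfolding e_def
    by (intro sum.cong refl arg_cong[where f = "(*) _"] eval_mpoly_superset[OF M, symmetric])
      (auto simp: M_def)
  finally show ?thesis .
qed

section \<open>Rank under multiplication by an invertible matrix\<close>

lemma index_mult_mat_eq_sum:
  assumes "X \<in> carrier_mat r m" "Y \<in> carrier_mat m c" "i < r" "j < c"
  shows "(X * Y) $$ (i, j) = (\<Sum>k<m. X $$ (i, k) * Y $$ (k, j))"
  using assms by (auto simp: scalar_prod_def lessThan_atLeast0 intro!: sum.cong)

text \<open>Having the left inverse \<open>S\<close>, the map given by \<open>T\<close> is
  injective, so it carries a maximal independent set of columns of \<open>A\<close> to an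
  independent set of equally many columns of \<open>T * A\<close>.\<close>

lemma (in vec_space) rank_le_rank_mult_left:
  assumes T: "T \<in> carrier_mat n n" and S: "S \<in> carrier_mat n n" and ST: "S * T = 1\<^sub>m n"
    and A: "A \<in> carrier_mat n nc"
  shows "rank A \<le> rank (T * A)"
proof -
  have cancel: "v = w" if "T *\<^sub>v v = T *\<^sub>v w" "v \<in> carrier_vec n" "w \<in> carrier_vec n" for v w
  proof -
    have "S *\<^sub>v (T *\<^sub>v x) = x" if "x \<in> carrier_vec n" for x
      using that S T ST by (simp flip: assoc_mult_mat_vec)
    then show ?thesis using that by metis
  qed
  obtain U where U: "maximal U (\<lambda>U. U \<subseteq> set (cols A) \<and> lin_indpt U)"
    using maximal_exists_superset[of "set (cols A)" "\<lambda>U. U \<subseteq> set (cols A) \<and> lin_indpt U" "{}"]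
    by (auto simp: lin_dep_def)
  then have UA: "U \<subseteq> set (cols A)" and indpt: "lin_indpt U" by (auto simp: maximal_def)
  obtain us where us: "set us = U" "distinct us"
    using UA by (meson List.finite_set finite_distinct_list finite_subset)
  have us_n: "set us \<subseteq> carrier_vec n" using UA us cols_dim[of A] A by auto
  \<comment> \<open>The chosen columns are collected without repetition into a matrix, so that
    linear dependence becomes the existence of a nonzero kernel vector.\<close>
  define M where "M = mat_of_cols n us"
  have M: "M \<in> carrier_mat n (length us)" unfolding M_def by simp
  have cols_M: "cols M = us" unfolding M_def using us_n by simp
  have TM: "T * M \<in> carrier_mat n (length us)" using T M by simp
  have "col M i = us ! i" if "i < length us" for i
    using that M cols_nth[of i M] by (simp add: cols_M)
  then have cols_TM: "cols (T * M) = map ((*\<^sub>v) T) us"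
    using TM M by (intro nth_equalityI) (simp_all add: col_mult2[OF T M])
  have "inj_on ((*\<^sub>v) T) (set us)" using cancel us_n by (intro inj_onI) auto
  then have dist: "distinct (cols (T * M))" by (simp add: cols_TM distinct_map us)
  have "lin_indpt (set (cols (T * M)))"
  proof
    assume "lin_dep (set (cols (T * M)))"
    from lin_depE[OF TM this dist] obtain v
      where v: "v \<in> carrier_vec (length us)" "v \<noteq> 0\<^sub>v (length us)" "(T * M) *\<^sub>v v = 0\<^sub>v n" .
    \<comment> \<open>Cancelling \<open>T\<close> turns a kernel vector of \<open>T * M\<close> into
      one of \<open>M\<close>, against the independence of \<open>U\<close>.\<close>
    have "T *\<^sub>v (M *\<^sub>v v) = 0\<^sub>v n" using v T M by (simp flip: assoc_mult_mat_vec)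
    also have "\<dots> = T *\<^sub>v 0\<^sub>v n" using T by (intro eq_vecI) auto
    finally have "T *\<^sub>v (M *\<^sub>v v) = T *\<^sub>v 0\<^sub>v n" .
    then have "M *\<^sub>v v = 0\<^sub>v n" using cancel v M by simp
    then have "lin_dep (set (cols M))" using lin_depI[OF M v(1,2)] us cols_M by simp
    then show False using indpt us cols_M by simp
  qed
  moreover have "set (cols (T * M)) \<subseteq> set (cols (T * A))"
  proof
    fix x assume "x \<in> set (cols (T * M))"
    then obtain u where u: "u \<in> set (cols A)" "x = T *\<^sub>v u" using us UA by (auto simp: cols_TM)
    then obtain j where j: "j < nc" "u = col A j" using A by (auto simp: cols_def)
    then have "x = cols (T * A) ! j" "j < length (cols (T * A))"
      using T A u by (auto simp: col_mult2[OF T A])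
    then show "x \<in> set (cols (T * A))" using nth_mem by metis
  qed
  ultimately have "card (set (cols (T * M))) \<le> rank (T * A)"
    using T A by (intro rank_ge_card_indpt[of _ nc]) auto
  moreover have "card (set (cols (T * M))) = rank A"
    using distinct_card[OF dist] distinct_card[OF us(2)] rank_card_indpt[OF A U] us
    by (simp add: cols_TM)
  ultimately show ?thesis by simp
qed

text \<open>The preceding inequality is applied twice: to \<open>T\<close> acting on
  \<open>A\<close>, and to \<open>S\<close> acting on \<open>T * A\<close>, which gives back
  \<open>A\<close>.\<close>

lemma (in vec_space) rank_mult_left_inverse:
  assumes T: "T \<in> carrier_mat n n" and S: "S \<in> carrier_mat n n"
    and TS: "T * S = 1\<^sub>m n" and ST: "S * T = 1\<^sub>m n"
    and A: "A \<in> carrier_mat n nc"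
  shows "rank (T * A) = rank A"
proof -
  have "S * (T * A) = A" using S T A ST by (simp flip: assoc_mult_mat)
  then show ?thesis
    using rank_le_rank_mult_left[OF T S ST A] rank_le_rank_mult_left[OF S T TS, of "T * A" nc] T A
    by simp
qed

section \<open>What leading blocks inherit: constant rank and the ACI property\<close>

text \<open>With equal dimensions nothing is cut off. Completion commutes with constant row
  combinations, so each completion of \<open>B\<close> is \<open>T\<close> times the completion of
  \<open>A\<close> under the same assignment, with its columns permuted.\<close>

lemma constant_rank_leading_block_eq_dim:
  assumes lb: "leading_block B A" and dims: "dim_row B = dim_row A" "dim_col B = dim_col A"
  shows "constant_rank B \<rho> \<longleftrightarrow> constant_rank A \<rho>"
proof -
  define m n where "m = dim_row A" and "n = dim_col A"
  from lb obtain T S \<pi> where T: "T \<in> carrier_mat m m" and S: "S \<in> carrier_mat m m"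
    and TS: "T * S = 1\<^sub>m m" and ST: "S * T = 1\<^sub>m m" and \<pi>: "\<pi> permutes {..<n}"
    and B: "\<And>i j. i < m \<Longrightarrow> j < n \<Longrightarrow>
      B $$ (i, j) = (\<Sum>k<m. const_mpoly (T $$ (i, k)) * A $$ (k, \<pi> j))"
    unfolding leading_block_def dims m_def[symmetric] n_def[symmetric] by blast
  have "vec_space.rank m (completion \<alpha> B) = vec_space.rank m (completion \<alpha> A)" for \<alpha>
  proof -
    let ?A = "completion \<alpha> A" and ?B = "completion \<alpha> B"
    have A: "?A \<in> carrier_mat m n" and B': "?B \<in> carrier_mat m n"
      by (auto simp: completion_def m_def n_def dims)
    have \<pi>_less: "\<pi> j < n" if "j < n" for j using permutes_in_image[OF \<pi>, of j] that by simp
    have "?B $$ (i, j) = (T * ?A) $$ (i, \<pi> j)" if "i < m" "j < n" for i j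
    proof -
      have "?B $$ (i, j) = (\<Sum>k<m. T $$ (i, k) * eval_mpoly \<alpha> (A $$ (k, \<pi> j)))"
        using that by (simp add: completion_def B eval_mpoly_const_mpoly_sum dims flip: m_def n_def)
      also have "\<dots> = (T * ?A) $$ (i, \<pi> j)"
        using that T \<pi>_less[of j]
        by (auto simp: completion_def scalar_prod_def lessThan_atLeast0 simp flip: m_def n_def
            intro!: sum.cong)
      finally show ?thesis .
    qed
    then have "col ?B j = col (T * ?A) (\<pi> j)" if "j < n" for j
      using that \<pi>_less[of j] T A B' by (intro eq_vecI) auto
    \<comment> \<open>The rank is the dimension of the span of the set of columns, so it does not
      see their order.\<close>
    then have "set (cols ?B) = col (T * ?A) ` \<pi> ` {..<n}"
      using B' by (auto simp: cols_def lessThan_atLeast0)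
    also have "\<dots> = set (cols (T * ?A))"
      using permutes_image[OF \<pi>] A by (auto simp: cols_def lessThan_atLeast0)
    finally have "vec_space.rank m ?B = vec_space.rank m (T * ?A)"
      by (simp add: vec_space.rank_def)
    then show ?thesis using vec_space.rank_mult_left_inverse[OF T S TS ST A] by simp
  qed
  then show ?thesis by (simp add: constant_rank_def dims m_def)
qed

text \<open>Column \<open>j\<close> of \<open>B\<close> combines entries of the single column
  \<open>\<pi> j\<close> of \<open>A\<close> with constant coefficients. Distinct columns of
  \<open>B\<close> come from distinct columns of \<open>A\<close>, since \<open>\<pi>\<close> is
  injective.\<close>

lemma aci_matrix_leading_block:
  assumes "leading_block B A" and aci: "aci_matrix A"
  shows "aci_matrix B"
proof -
  define m n where "m = dim_row A" and "n = dim_col A"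
  from assms(1) obtain T \<pi> where \<pi>: "\<pi> permutes {..<n}" and c: "dim_col B \<le> n"
    and B: "\<And>i j. i < dim_row B \<Longrightarrow> j < dim_col B \<Longrightarrow>
      B $$ (i, j) = (\<Sum>k<m. const_mpoly (T $$ (i, k)) * A $$ (k, \<pi> j))"
    unfolding leading_block_def m_def n_def by blast
  have \<pi>_less: "\<pi> j < n" if "j < dim_col B" for j
    using permutes_in_image[OF \<pi>, of j] that c by simp
  have disjoint: "indets (A $$ (k, \<pi> j)) \<inter> indets (A $$ (k', \<pi> j')) = {}"
    if "k < m" "k' < m" "j < dim_col B" "j' < dim_col B" "j \<noteq> j'" for k k' j j'
    using aci that \<pi>_less inj_eq[OF permutes_inj[OF \<pi>]]
    unfolding aci_matrix_def m_def n_def by metis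
  have "indets (B $$ (i, j)) \<subseteq> (\<Union>k<m. indets (A $$ (k, \<pi> j)))"
    if "i < dim_row B" "j < dim_col B" for i j
    using that by (simp add: B indets_const_mpoly_sum)
  then have "indets (B $$ (i, j)) \<inter> indets (B $$ (i', j')) = {}"
    if "i < dim_row B" "i' < dim_row B" "j < dim_col B" "j' < dim_col B" "j \<noteq> j'" for i i' j j'
    using that disjoint[OF _ _ that(3-5)] by blast
  moreover have "degree_at_most 1 (B $$ (i, j))" if "i < dim_row B" "j < dim_col B" for i j
    unfolding B[OF that] using aci \<pi>_less[OF that(2)]
    by (intro degree_at_most_const_mpoly_sum) (auto simp: aci_matrix_def m_def n_def)
  ultimately show ?thesis unfolding aci_matrix_def by blast
qed

section \<open>Transitivity of the leading block relation\<close>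

text \<open>The composite transformation is diag(\<open>T'\<close>, 1) \<open>T\<close> with inverse
  \<open>S\<close> diag(\<open>S'\<close>, 1), and the column permutation is
  \<open>\<pi> \<circ> \<sigma>\<close>.\<close>

lemma leading_block_trans:
  assumes CB: "leading_block C B" and BA: "leading_block B A"
  shows "leading_block C A"
proof -
  define m n where "m = dim_row A" and "n = dim_col A"
  define r c where "r = dim_row B" and "c = dim_col B"
  from BA obtain T S \<pi> where rm: "r \<le> m" and cn: "c \<le> n"
    and T: "T \<in> carrier_mat m m" and S: "S \<in> carrier_mat m m"
    and TS: "T * S = 1\<^sub>m m" and ST: "S * T = 1\<^sub>m m" and \<pi>: "\<pi> permutes {..<n}"
    and B: "\<And>i j. i < r \<Longrightarrow> j < c \<Longrightarrow>
      B $$ (i, j) = (\<Sum>k<m. const_mpoly (T $$ (i, k)) * A $$ (k, \<pi> j))"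
    unfolding leading_block_def m_def n_def r_def c_def by blast
  from CB obtain T' S' \<sigma> where Cr: "dim_row C \<le> r" and Cc: "dim_col C \<le> c"
    and T': "T' \<in> carrier_mat r r" and S': "S' \<in> carrier_mat r r"
    and TS': "T' * S' = 1\<^sub>m r" and ST': "S' * T' = 1\<^sub>m r" and \<sigma>: "\<sigma> permutes {..<c}"
    and C: "\<And>i j. i < dim_row C \<Longrightarrow> j < dim_col C \<Longrightarrow>
      C $$ (i, j) = (\<Sum>k<r. const_mpoly (T' $$ (i, k)) * B $$ (k, \<sigma> j))"
    unfolding leading_block_def r_def c_def by blast
  let ?pad = "\<lambda>X. four_block_mat X (0\<^sub>m r (m - r)) (0\<^sub>m (m - r) r) (1\<^sub>m (m - r))"
  have pad_carrier: "?pad X \<in> carrier_mat m m" if "X \<in> carrier_mat r r" for X :: "'a mat"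
    using four_block_carrier_mat[OF that one_carrier_mat[of "m - r"]] rm by simp
  have pad_mult: "?pad X * ?pad Y = 1\<^sub>m m"
    if "X \<in> carrier_mat r r" "Y \<in> carrier_mat r r" "X * Y = 1\<^sub>m r" for X Y :: "'a mat"
    using rm that by (subst mult_four_block_mat[of _ r r _ "m - r" _ "m - r" _ _ r _ "m - r"]) auto
  note P = pad_carrier[OF T'] and Q = pad_carrier[OF S']
  let ?U = "?pad T' * T" and ?V = "S * ?pad S'"
  have "?U * ?V = ?pad T' * ((T * S) * ?pad S')"
    using P Q T S by (simp add: assoc_mult_mat[of _ m m _ m _ m])
  then have UV: "?U * ?V = 1\<^sub>m m" using left_mult_one_mat[OF Q] TS pad_mult[OF T' S' TS'] by metis
  have "?V * ?U = S * ((?pad S' * ?pad T') * T)"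
    using P Q T S by (simp add: assoc_mult_mat[of _ m m _ m _ m])
  then have VU: "?V * ?U = 1\<^sub>m m" using left_mult_one_mat[OF T] ST pad_mult[OF S' T' ST'] by metis
  \<comment> \<open>In the first \<open>r\<close> rows the upper right block of the padded matrix is
    zero, so only rows of \<open>T\<close> with index below \<open>r\<close> enter. These are the
    rows for which \<open>B\<close> is described by \<open>T\<close>.\<close>
  have U_row: "?U $$ (i, k) = (\<Sum>l<r. T' $$ (i, l) * T $$ (l, k))" if "i < r" "k < m" for i k
  proof -
    have "?U $$ (i, k) = (\<Sum>l<m. ?pad T' $$ (i, l) * T $$ (l, k))"
      using that rm by (intro index_mult_mat_eq_sum[OF P T]) simp_all
    also have "\<dots> = (\<Sum>l<r. ?pad T' $$ (i, l) * T $$ (l, k))"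
      using that rm T' by (intro sum.mono_neutral_right) auto
    also have "\<dots> = (\<Sum>l<r. T' $$ (i, l) * T $$ (l, k))"
      using that rm T' by (intro sum.cong) auto
    finally show ?thesis .
  qed
  have "C $$ (i, j) = (\<Sum>k<m. const_mpoly (?U $$ (i, k)) * A $$ (k, (\<pi> \<circ> \<sigma>) j))"
    if i: "i < dim_row C" and j: "j < dim_col C" for i j
  proof -
    have \<sigma>j: "\<sigma> j < c" using permutes_in_image[OF \<sigma>, of j] j Cc by simp
    have "C $$ (i, j) = (\<Sum>l<r. \<Sum>k<m.
        const_mpoly (T' $$ (i, l)) * const_mpoly (T $$ (l, k)) * A $$ (k, \<pi> (\<sigma> j)))"
      using i j \<sigma>j by (simp add: C B sum_distrib_left mult.assoc)
    also have "\<dots> = (\<Sum>k<m. const_mpoly (?U $$ (i, k)) * A $$ (k, \<pi> (\<sigma> j)))"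
      unfolding sum.swap[of _ "{..<m}" "{..<r}"] using i Cr
      by (intro sum.cong refl) (simp add: U_row const_mpoly_sum const_mpoly_mult sum_distrib_right
          del: index_mult_mat)
    finally show ?thesis by simp
  qed
  \<comment> \<open>As a permutation of the first \<open>c\<close> indices, \<open>\<sigma>\<close>
    fixes all others and so also permutes the first \<open>n\<close>.\<close>
  moreover have "\<pi> \<circ> \<sigma> permutes {..<n}"
    using \<pi> permutes_subset[OF \<sigma>, of "{..<n}"] cn by (auto intro: permutes_compose)
  moreover have "?U \<in> carrier_mat m m" "?V \<in> carrier_mat m m" using P Q T S by auto
  ultimately show ?thesis
    unfolding leading_block_def m_def[symmetric] n_def[symmetric]
    using UV VU Cr rm Cc cn by (intro conjI exI[of _ ?U] exI[of _ ?V] exI[of _ "\<pi> \<circ> \<sigma>"]) auto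
qed

section \<open>Submatrices as leading blocks\<close>

text \<open>The domain and the image of \<open>f\<close> have equally large complements in
  \<open>{..<n}\<close>, and any bijection \<open>g\<close> between these completes
  \<open>f\<close>.\<close>

lemma inj_on_lessThan_extends_to_permutation:
  fixes f :: "nat \<Rightarrow> nat"
  assumes inj: "inj_on f {..<k}" and img: "f ` {..<k} \<subseteq> {..<n}"
  obtains \<pi> where "\<pi> permutes {..<n}" "\<And>i. i < k \<Longrightarrow> \<pi> i = f i"
proof -
  have kn: "k \<le> n" using card_inj_on_le[OF inj img] by simp
  have "card ({..<n} - {..<k}) = card ({..<n} - f ` {..<k})"
    using card_image[OF inj] kn img by (simp add: card_Diff_subset)
  then obtain g where g: "bij_betw g ({..<n} - {..<k}) ({..<n} - f ` {..<k})"
    using finite_same_card_bij[of "{..<n} - {..<k}" "{..<n} - f ` {..<k}"] by auto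
  let ?\<pi> = "\<lambda>i. if i < k then f i else if i < n then g i else i"
  have "bij_betw ?\<pi> ({..<k} \<union> ({..<n} - {..<k})) (f ` {..<k} \<union> ({..<n} - f ` {..<k}))"
  proof (rule bij_betw_combine)
    show "bij_betw ?\<pi> {..<k} (f ` {..<k})"
      using bij_betw_cong[of "{..<k}" ?\<pi> f] inj_on_imp_bij_betw[OF inj] by simp
    show "bij_betw ?\<pi> ({..<n} - {..<k}) ({..<n} - f ` {..<k})"
      using bij_betw_cong[of "{..<n} - {..<k}" ?\<pi> g] g by simp
  qed auto
  moreover have "{..<k} \<union> ({..<n} - {..<k}) = {..<n}" "f ` {..<k} \<union> ({..<n} - f ` {..<k}) = {..<n}"
    using kn img by auto
  ultimately have "?\<pi> permutes {..<n}" using kn by (intro bij_imp_permutes) auto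
  then show ?thesis using that by auto
qed

text \<open>The enumeration \<open>pick I\<close> is strictly increasing on the first
  \<open>k\<close> indices and stays below \<open>n\<close> there, so it is an injection to which
  the extension lemma applies.\<close>

lemma pick_extends_to_permutation:
  assumes "k = card {i. i < n \<and> i \<in> I}"
  obtains \<pi> where "\<pi> permutes {..<n}" "\<And>i. i < k \<Longrightarrow> \<pi> i = pick I i"
proof -
  have mono: "pick I i < pick I j" if "i < j" "j < k" for i j
  proof -
    \<comment> \<open>The set \<open>I\<close> may be infinite, as complements of singletons are; it
      is replaced by its finite part below \<open>n\<close>, which has the same first
      \<open>k\<close> elements.\<close>
    have "pick I i = pick {a. a < n \<and> a \<in> I} i" "pick I j = pick {a. a < n \<and> a \<in> I} j"
      using that assms by (intro pick_reduce_set; simp)+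
    then show ?thesis using that assms by (simp add: pick_mono_le)
  qed
  have inj: "inj_on (pick I) {..<k}"
    by (rule linorder_inj_onI) (use mono in fastforce)+
  have "pick I ` {..<k} \<subseteq> {..<n}" using assms pick_le by auto
  then show ?thesis using inj_on_lessThan_extends_to_permutation[OF inj] that by metis
qed

text \<open>A permutation of rows and one of columns bring the selected indices to the front in
  their order. Deletion of a row or a column is the case where one index set omits a single index
  and the other is \<open>UNIV\<close>.\<close>

lemma leading_block_submatrix: "leading_block (submatrix A I J) A"
proof -
  define m n where "m = dim_row A" and "n = dim_col A"
  let ?r = "dim_row (submatrix A I J)" and ?c = "dim_col (submatrix A I J)"
  have r: "?r = card {i. i < m \<and> i \<in> I}" and c: "?c = card {j. j < n \<and> j \<in> J}"
    by (simp_all add: dim_submatrix m_def n_def)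
  obtain \<sigma> where \<sigma>: "\<sigma> permutes {..<m}" and \<sigma>_pick: "\<And>i. i < ?r \<Longrightarrow> \<sigma> i = pick I i"
    using pick_extends_to_permutation[OF r] by blast
  obtain \<pi> where \<pi>: "\<pi> permutes {..<n}" and \<pi>_pick: "\<And>j. j < ?c \<Longrightarrow> \<pi> j = pick J j"
    using pick_extends_to_permutation[OF c] by blast
  have rm: "?r \<le> m" and cn: "?c \<le> n"
    unfolding r c using card_mono[of "{..<m}" "{i. i < m \<and> i \<in> I}"]
      card_mono[of "{..<n}" "{j. j < n \<and> j \<in> J}"] by auto
  have \<sigma>_less: "\<sigma> i < m \<longleftrightarrow> i < m" for i using permutes_in_image[OF \<sigma>, of i] by simp
  have \<sigma>_eq: "\<sigma> i = \<sigma> j \<longleftrightarrow> i = j" for i j using permutes_inj[OF \<sigma>] by (simp add: inj_eq)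
  \<comment> \<open>Row \<open>i\<close> of \<open>T\<close> has its 1 in position
    \<open>\<sigma> i\<close>, so multiplying by \<open>T\<close> puts row \<open>\<sigma> i\<close>
    of \<open>A\<close> in place \<open>i\<close>. The inverse \<open>S\<close> is the
    transpose.\<close>
  define T S :: "'a mat" where "T = mat m m (\<lambda>(i, k). if k = \<sigma> i then 1 else 0)"
    and "S = mat m m (\<lambda>(k, i). if k = \<sigma> i then 1 else 0)"
  have "T * S = 1\<^sub>m m"
  proof (rule eq_matI)
    fix i j assume "i < dim_row (1\<^sub>m m :: 'a mat)" "j < dim_col (1\<^sub>m m :: 'a mat)"
    then show "(T * S) $$ (i, j) = 1\<^sub>m m $$ (i, j)"
      using \<sigma>_less by (auto simp: T_def S_def scalar_prod_def if_distrib \<sigma>_eq cong: if_cong)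
  qed (auto simp: T_def S_def)
  moreover have "S * T = 1\<^sub>m m"
  proof (rule eq_matI)
    fix i j assume "i < dim_row (1\<^sub>m m :: 'a mat)" "j < dim_col (1\<^sub>m m :: 'a mat)"
    then have ij: "i < m" "j < m" by auto
    \<comment> \<open>Row \<open>i\<close> of \<open>S\<close> has its 1 at the preimage of
      \<open>i\<close> under \<open>\<sigma>\<close>, and the sum for the product collapses to that
      index.\<close>
    obtain i' where i': "i = \<sigma> i'" using surjD[OF permutes_surj[OF \<sigma>], of i] by blast
    have "i' < m" using ij(1) \<sigma>_less i' by simp
    have "(S * T) $$ (i, j) = (\<Sum>k<m. S $$ (i, k) * T $$ (k, j))"
      using ij by (intro index_mult_mat_eq_sum[of _ m _ _ m]) (simp_all add: S_def T_def)
    also have "\<dots> = (\<Sum>k<m. if k = i' then (if i = j then 1 else 0) else 0)"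
      using ij \<open>i' < m\<close> by (intro sum.cong refl) (auto simp: S_def T_def i' \<sigma>_eq)
    also have "\<dots> = 1\<^sub>m m $$ (i, j)" using ij \<open>i' < m\<close> by simp
    finally show "(S * T) $$ (i, j) = 1\<^sub>m m $$ (i, j)" .
  qed (auto simp: T_def S_def)
  moreover have "submatrix A I J $$ (i, j) = (\<Sum>k<m. const_mpoly (T $$ (i, k)) * A $$ (k, \<pi> j))"
    if "i < ?r" "j < ?c" for i j
  proof -
    have "(\<Sum>k<m. const_mpoly (T $$ (i, k)) * A $$ (k, \<pi> j))
        = (\<Sum>k<m. if k = \<sigma> i then A $$ (k, \<pi> j) else 0)"
      using that rm by (intro sum.cong) (auto simp: T_def const_mpoly_0 const_mpoly_1)
    also have "\<dots> = A $$ (pick I i, pick J j)"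
      using that rm \<sigma>_less[of i] \<sigma>_pick[of i] \<pi>_pick[of j] by simp
    finally show ?thesis using that by (simp add: submatrix_index dim_submatrix)
  qed
  ultimately show ?thesis
    unfolding leading_block_def m_def[symmetric] n_def[symmetric]
    using rm cn \<pi> by (intro conjI exI[of _ T] exI[of _ S] exI[of _ \<pi>]) (auto simp: T_def S_def)
qed

lemma leading_block_refl: "leading_block A A"
proof -
  have "submatrix A UNIV UNIV = A"
    by (rule eq_matI) (auto simp: submatrix_def pick_UNIV)
  then show ?thesis using leading_block_submatrix[of A UNIV UNIV] by simp
qed

section \<open>Translation between leading blocks and equivalence\<close>

lemma mult_permutation_matrix_right:
  assumes M: "M \<in> carrier_mat m n" and \<pi>: "\<pi> permutes {..<n}" and ij: "i < m" "j < n"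
  shows "(M * mat n n (\<lambda>(i, j). if i = \<pi> j then 1 else 0)) $$ (i, j)
    = (M $$ (i, \<pi> j) :: 'a::comm_ring_1)"
proof -
  have "\<pi> j < n" using permutes_in_image[OF \<pi>, of j] ij by simp
  then show ?thesis using M ij by (simp add: scalar_prod_def if_distrib cong: if_cong)
qed

text \<open>This links the product TAQ in \<open>aci_equiv\<close> with the entrywise sum in
  \<open>leading_block\<close>.\<close>

lemma index_const_mpoly_mult_permutation_matrix:
  assumes T: "T \<in> carrier_mat (dim_row A) (dim_row A)" and \<pi>: "\<pi> permutes {..<dim_col A}"
    and ij: "i < dim_row A" "j < dim_col A"
  shows "(map_mat const_mpoly T * A * mat (dim_col A) (dim_col A) (\<lambda>(i, j). if i = \<pi> j then 1 else 0))
      $$ (i, j)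
    = (\<Sum>k<dim_row A. const_mpoly (T $$ (i, k) :: 'a::comm_ring_1) * A $$ (k, \<pi> j))"
proof -
  have "\<pi> j < dim_col A" using permutes_in_image[OF \<pi>, of j] ij by simp
  then have "(map_mat const_mpoly T * A) $$ (i, \<pi> j)
      = (\<Sum>k<dim_row A. const_mpoly (T $$ (i, k)) * A $$ (k, \<pi> j))"
    using T ij by (auto simp: scalar_prod_def lessThan_atLeast0 intro!: sum.cong)
  moreover have TA: "map_mat const_mpoly T * A \<in> carrier_mat (dim_row A) (dim_col A)"
    using T by auto
  ultimately show ?thesis by (simp only: mult_permutation_matrix_right[OF TA \<pi> ij])
qed

lemma aci_equiv_leading_block:
  assumes "aci_equiv A B"
  shows "leading_block B A"
proof -
  from assms obtain T Q where dims: "dim_row A = dim_row B" "dim_col A = dim_col B"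
    and T: "T \<in> carrier_mat (dim_row A) (dim_row A)" and inv: "invertible_mat T"
    and Q: "permutation_matrix (dim_col A) Q" and B: "B = map_mat const_mpoly T * A * Q"
    unfolding aci_equiv_def by blast
  from Q obtain \<pi> where \<pi>: "\<pi> permutes {..<dim_col A}"
    and Q_eq: "Q = mat (dim_col A) (dim_col A) (\<lambda>(i, j). if i = \<pi> j then 1 else 0)"
    unfolding permutation_matrix_def by blast
  from inv obtain S where TS: "T * S = 1\<^sub>m (dim_row A)" and ST: "S * T = 1\<^sub>m (dim_row S)"
    using T unfolding invertible_mat_def inverts_mat_def by auto
  \<comment> \<open>Invertibility supplies \<open>S\<close> without its dimensions; they are read
    off from the two product identities.\<close>
  have S: "S \<in> carrier_mat (dim_row A) (dim_row A)"
  proof (rule carrier_matI)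
    show "dim_col S = dim_row A" using arg_cong[OF TS, of dim_col] by simp
    have "dim_col T = dim_row S" using arg_cong[OF ST, of dim_col] by simp
    then show "dim_row S = dim_row A" using carrier_matD(2)[OF T] by simp
  qed
  have "B $$ (i, j) = (\<Sum>k<dim_row A. const_mpoly (T $$ (i, k)) * A $$ (k, \<pi> j))"
    if "i < dim_row A" "j < dim_col A" for i j
    unfolding B Q_eq by (rule index_const_mpoly_mult_permutation_matrix[OF T \<pi> that])
  moreover have "S * T = 1\<^sub>m (dim_row A)" using ST carrier_matD(1)[OF S] by simp
  ultimately show ?thesis
    by (intro leading_blockI[OF _ _ T S TS _ \<pi>]) (simp_all only: dims order_refl)
qed

text \<open>The transformation witnessing the block acts on all of \<open>A\<close>. The full
  product \<open>M\<close> is equivalent to \<open>A\<close>, its upper left corner is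
  \<open>B\<close>, and the other three blocks are whatever remains, possibly void.\<close>

lemma leading_block_imp_four_block:
  assumes lb: "leading_block B A" and aci: "aci_matrix A"
  shows "\<exists>p q X Y Z. X \<in> carrier_mat (dim_row B) q \<and> Y \<in> carrier_mat p (dim_col B) \<and>
    Z \<in> carrier_mat p q \<and> aci_equiv A (four_block_mat B X Y Z)"
proof -
  define m n where "m = dim_row A" and "n = dim_col A"
  from lb obtain T S \<pi> where dims: "dim_row B \<le> m" "dim_col B \<le> n"
    and T: "T \<in> carrier_mat m m" and S: "S \<in> carrier_mat m m"
    and TS: "T * S = 1\<^sub>m m" and ST: "S * T = 1\<^sub>m m" and \<pi>: "\<pi> permutes {..<n}"
    and B: "\<And>i j. i < dim_row B \<Longrightarrow> j < dim_col B \<Longrightarrow>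
      B $$ (i, j) = (\<Sum>k<m. const_mpoly (T $$ (i, k)) * A $$ (k, \<pi> j))"
    unfolding leading_block_def m_def[symmetric] n_def[symmetric] by blast
  define Q :: "'a mpoly mat" where "Q = mat n n (\<lambda>(i, j). if i = \<pi> j then 1 else 0)"
  define M where "M = map_mat const_mpoly T * A * Q"
  have M_dims: "dim_row M = m" "dim_col M = n" using T by (auto simp: M_def Q_def)
  have M: "M $$ (i, j) = (\<Sum>k<m. const_mpoly (T $$ (i, k)) * A $$ (k, \<pi> j))"
    if "i < m" "j < n" for i j
    using index_const_mpoly_mult_permutation_matrix[of T A \<pi> i j] T \<pi> that
    by (simp add: M_def Q_def m_def n_def)
  have "leading_block M A"
    using leading_blockI[of M A T S \<pi>] T S TS ST \<pi> M_dims M by (simp flip: m_def n_def)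
  then have "aci_matrix M" using aci by (rule aci_matrix_leading_block)
  moreover have "invertible_mat T"
    unfolding invertible_mat_def inverts_mat_def using T S TS ST by auto
  moreover have "permutation_matrix n Q" using \<pi> by (auto simp: permutation_matrix_def Q_def)
  ultimately have equiv: "aci_equiv A M"
    unfolding aci_equiv_def using aci T M_dims M_def by (auto simp: m_def n_def)
  obtain B' X Y Z where split: "split_block M (dim_row B) (dim_col B) = (B', X, Y, Z)"
    by (metis prod_cases4)
  have "B' = mat (dim_row B) (dim_col B) (\<lambda>ij. M $$ ij)"
    using split by (auto simp: split_block_def Let_def)
  then have "B' = B" using dims by (intro eq_matI) (simp_all add: M B)
  moreover note split_block[OF split, of "m - dim_row B" "n - dim_col B"]
  ultimately have "X \<in> carrier_mat (dim_row B) (n - dim_col B)"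
    "Y \<in> carrier_mat (m - dim_row B) (dim_col B)"
    "Z \<in> carrier_mat (m - dim_row B) (n - dim_col B)" "M = four_block_mat B X Y Z"
    using dims M_dims by simp_all
  then show ?thesis using equiv by blast
qed

section \<open>Descent to a completely irreducible block\<close>

text \<open>Strong induction on the number of rows plus columns: passing to an equivalent matrix
  keeps both numbers, and the deletion that follows lowers their sum.\<close>

lemma exists_completely_irreducible_leading_block:
  assumes "aci_matrix A" and "constant_rank A \<rho>"
  shows "\<exists>A'. leading_block A' A \<and> completely_irreducible A' \<and> constant_rank A' \<rho>"
  using assms
proof (induction "dim_row A + dim_col A" arbitrary: A rule: less_induct)
  case less
  show ?case
  proof (cases "completely_irreducible A")
    case True
    then show ?thesis using leading_block_refl less.prems by blast
  next
    case False
    then obtain B where equiv: "aci_equiv A B" and red: "aci_reducible B"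
      unfolding completely_irreducible_def by blast
    have lb: "leading_block B A" using aci_equiv_leading_block[OF equiv] .
    have dims: "dim_row B = dim_row A" "dim_col B = dim_col A"
      using equiv by (auto simp: aci_equiv_def)
    have rank: "constant_rank B \<rho>"
      using constant_rank_leading_block_eq_dim[OF lb dims] less.prems by simp
    \<comment> \<open>Reducibility quantifies over its own rank; comparing any completion identifies
      that rank with \<open>\<rho>\<close>.\<close>
    have \<rho>_unique: "\<rho>' = \<rho>" if "constant_rank B \<rho>'" for \<rho>'
      using that rank unfolding constant_rank_def by simp
    have card_less: "card {i. i < k \<and> i \<in> - {l}} < k" if "l < k" for k l :: nat
    proof -
      have "card {i. i < k \<and> i \<in> - {l}} < card {..<k}"
        using that by (intro psubset_card_mono) auto
      then show ?thesis by simp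
    qed
    \<comment> \<open>Deleting a row and deleting a column are both written as a submatrix, so that
      one argument finishes both cases.\<close>
    have "\<exists>I J. constant_rank (submatrix B I J) \<rho> \<and>
      dim_row (submatrix B I J) + dim_col (submatrix B I J) < dim_row A + dim_col A"
    proof (cases "row_reducible B")
      case True
      then obtain i where "i < dim_row B" "constant_rank (submatrix B (- {i}) UNIV) \<rho>"
        unfolding row_reducible_def delete_row_def using \<rho>_unique by blast
      then show ?thesis using card_less[of i "dim_row B"] dims
        by (intro exI[of _ "- {i}"] exI[of _ UNIV]) (simp add: dim_submatrix)
    next
      case False
      then obtain j where "j < dim_col B" "constant_rank (submatrix B UNIV (- {j})) \<rho>"
        using red unfolding aci_reducible_def column_reducible_def delete_col_def
        using \<rho>_unique by blast
      then show ?thesis using card_less[of j "dim_col B"] dims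
        by (intro exI[of _ UNIV] exI[of _ "- {j}"]) (simp add: dim_submatrix)
    qed
    then obtain I J where rank': "constant_rank (submatrix B I J) \<rho>"
      and smaller: "dim_row (submatrix B I J) + dim_col (submatrix B I J) < dim_row A + dim_col A"
      by blast
    have lb': "leading_block (submatrix B I J) A"
      using leading_block_submatrix lb by (rule leading_block_trans)
    then obtain A' where "leading_block A' (submatrix B I J)" "completely_irreducible A'"
        "constant_rank A' \<rho>"
      using less.hyps[OF smaller _ rank'] aci_matrix_leading_block less.prems by blast
    then show ?thesis using leading_block_trans lb' by blast
  qed
qed

theorem lemma5p2:
  fixes A :: "'a::field mpoly mat" and \<rho> :: nat
  assumes "aci_matrix A" and "constant_rank A \<rho>"
  shows "\<exists>A'. is_core A' A \<and> constant_rank A' \<rho>"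
proof -
  obtain A' where A': "leading_block A' A" "completely_irreducible A'" "constant_rank A' \<rho>"
    using exists_completely_irreducible_leading_block[OF assms] by blast
  then have "is_core A' A"
    unfolding is_core_def
    using aci_matrix_leading_block leading_block_imp_four_block assms by blast
  then show ?thesis using A'(3) by blast
qed

end
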